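(* Let $k,n$ be positive integers with $n\ge 400$ and $\lfloor n/5\rfloor\le k\le \lfloor n/2\rfloor$. Then $$\binom nk<e^{-(k-\lfloor n/5\rfloor)\frac {11}{12n^2}} \frac{n^{n-\frac 12}}{k^k(n-k)^{n-k}}<\Big(1-\frac{5(k-\lfloor n/5\rfloor)}{6n^2}\Big) \frac{n^{n-\frac 12}}{k^k(n-k)^{n-k}} <\Big(1-\frac{5(k-\lfloor n/5\rfloor)}{6n^2}\Big)\frac{2^n}{\sqrt n}.$$
   Context: $\lfloor x\rfloor$ denotes the greatest integer not exceeding $x$.
   Formalization: The second inequality is an equality when k = ⌊n/5⌋, and the third is an equality when k = n/2, so these two are stated as ≤ in general and as strict whenever k ≠ ⌊n/5⌋, respectively k ≠ n/2; the first inequality is strict throughout. *)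

theory Defs
  imports Complex_Main
begin

end

theory Submission
  imports Defs "HOL-Analysis.Harmonic_Numbers"
begin

text \<open>
  Let \<open>F n k\<close> be the logarithm of \<open>n choose k\<close> divided by
  \<open>n powr (n - 1/2) / (k ^ k * (n - k) ^ (n - k))\<close>; the first inequality says
  \<open>F n k < - (k - n div 5) * 11 / (12 n\<^sup>2)\<close>. Three monotonicity properties of \<open>F\<close> reduce it to
  a single number: raising \<open>k\<close> by one lowers \<open>F\<close> by at least \<open>11 / (12 n\<^sup>2)\<close>, so that only
  \<open>k = n div 5\<close> matters; raising \<open>n\<close> does not lower \<open>F\<close>, so that only \<open>n = 5 k + 4\<close> matters; and
  \<open>F (5 k + 4) k\<close> decreases in \<open>k\<close>. They follow from elementary estimates of
  \<open>ln (x + 1) - ln x\<close>, the last one through the remainder in Stirling's formula, whose limit is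
  not needed. What is left is \<open>F 404 80 < 0\<close>, which holds only narrowly (the value is about
  \<open>- 1.3 / 10\<^sup>6\<close>) and is checked by integer arithmetic.
\<close>

lemma ln_plus_one_diff_ge:
  fixes x :: real
  assumes "0 < x"
  shows "2 / (2 * x + 1) \<le> ln (x + 1) - ln x"
  using ln_inverse_approx_ge[of x "x + 1"] assms by (simp flip: mult_2 add.assoc)

lemma mult_ln_plus_one_diff_ge:
  fixes x :: real
  assumes "0 < x"
  shows "1 - 1 / (2 * x + 1) \<le> x * (ln (x + 1) - ln x)"
proof -
  have "1 - 1 / (2 * x + 1) = x * (2 / (2 * x + 1))"
    using assms by (simp add: field_simps)
  also have "\<dots> \<le> x * (ln (x + 1) - ln x)"
    using ln_plus_one_diff_ge[OF assms] assms by (intro mult_left_mono) auto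
  finally show ?thesis .
qed

lemma mult_ln_plus_one_diff_le:
  fixes x :: real
  assumes "0 < x"
  shows "x * (ln (x + 1) - ln x) \<le> 1 - 1 / (2 * (x + 1))"
proof -
  have "x * (ln (x + 1) - ln x) \<le> x * ((inverse x + inverse (x + 1)) / 2)"
    using ln_inverse_approx_le[of x 1] assms by (intro mult_left_mono) auto
  also have "\<dots> = 1 - 1 / (2 * (x + 1))"
    using assms by (simp add: divide_simps) (simp add: algebra_simps)
  finally show ?thesis .
qed

text \<open>The trapezoidal rule on the two halves of the interval from \<open>x\<close> to \<open>x + 1\<close>.\<close>

lemma ln_plus_one_diff_le:
  fixes x :: real
  assumes "0 < x"
  shows "ln (x + 1) - ln x \<le> (1 / x + 4 / (2 * x + 1) + 1 / (x + 1)) / 4"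
proof -
  have half: "inverse (x + 1 / 2) = 2 / (2 * x + 1)"
    using assms by (simp add: field_simps)
  have "ln (x + 1 / 2) - ln x \<le> (1 / x + 2 / (2 * x + 1)) / 4"
    using ln_inverse_approx_le[of x "1 / 2"] assms half by (simp add: inverse_eq_divide)
  moreover have "ln (x + 1) - ln (x + 1 / 2) \<le> (2 / (2 * x + 1) + 1 / (x + 1)) / 4"
    using ln_inverse_approx_le[of "x + 1 / 2" "1 / 2"] assms half
    by (simp add: add.assoc inverse_eq_divide)
  ultimately show ?thesis by (simp add: field_simps)
qed

definition stirling_remainder :: "nat \<Rightarrow> real" where
  "stirling_remainder n = ln (fact n) - (real n + 1 / 2) * ln (real n) + real n"

lemma stirling_remainder_Suc:
  "stirling_remainder (Suc n)
     = stirling_remainder n + 1 - (real n + 1 / 2) * (ln (real n + 1) - ln (real n))"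
proof -
  have "ln (fact (Suc n) :: real) = ln (real n + 1) + ln (fact n)"
    unfolding fact_Suc by (subst ln_mult) (auto simp: add.commute)
  then show ?thesis
    unfolding stirling_remainder_def by (simp add: algebra_simps)
qed

lemma stirling_remainder_antimono:
  assumes "0 < m" "m \<le> n"
  shows "stirling_remainder n \<le> stirling_remainder m"
  using assms(2)
proof (induction n rule: dec_induct)
  case (step n)
  have "0 < real n" using step.hyps assms(1) by simp
  then have "(real n + 1 / 2) * (2 / (2 * real n + 1))
      \<le> (real n + 1 / 2) * (ln (real n + 1) - ln (real n))"
    by (intro mult_left_mono ln_plus_one_diff_ge) auto
  moreover have "(real n + 1 / 2) * (2 / (2 * real n + 1)) = 1"
    by (simp add: field_simps)
  ultimately show ?case
    using step.IH unfolding stirling_remainder_Suc by linarith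
qed simp

lemma stirling_remainder_minus_inverse_mono:
  assumes "0 < m" "m \<le> n"
  shows "stirling_remainder m - 1 / (8 * real m) \<le> stirling_remainder n - 1 / (8 * real n)"
  using assms(2)
proof (induction n rule: dec_induct)
  case (step n)
  have n: "0 < real n" using step.hyps assms(1) by simp
  then have "(real n + 1 / 2) * (ln (real n + 1) - ln (real n))
      \<le> (real n + 1 / 2) * ((1 / real n + 4 / (2 * real n + 1) + 1 / (real n + 1)) / 4)"
    by (intro mult_left_mono ln_plus_one_diff_le) auto
  also have "\<dots> = 1 + 1 / (8 * real n) - 1 / (8 * (real n + 1))"
    using n by (simp add: divide_simps) (simp add: algebra_simps)
  finally show ?case
    using step.IH by (simp add: stirling_remainder_Suc add.commute)
qed simp

definition binomial_envelope :: "nat \<Rightarrow> nat \<Rightarrow> real" where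
  "binomial_envelope n k
     = real n powr (real n - 1 / 2) / (real k ^ k * real (n - k) ^ (n - k))"

lemma binomial_envelope_pos:
  assumes "0 < k" "k < n"
  shows "0 < binomial_envelope n k"
  using assms by (simp add: binomial_envelope_def)

lemma ln_binomial_envelope:
  assumes "0 < k" "k < n"
  shows "ln (binomial_envelope n k) = (real n - 1 / 2) * ln (real n)
    - real k * ln (real k) - real (n - k) * ln (real (n - k))"
  using assms by (simp add: binomial_envelope_def ln_div ln_mult ln_realpow)

lemma binomial_envelope_altdef:
  assumes "0 < k" "k < n"
  shows "binomial_envelope n k
    = (real n / real k) ^ k * (real n / real (n - k)) ^ (n - k) / sqrt (real n)"
proof -
  have "real n powr (real n - 1 / 2) = real n ^ n / sqrt (real n)"
    using assms by (simp add: powr_diff powr_realpow powr_half_sqrt)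
  also have "real n ^ n = real n ^ k * real n ^ (n - k)"
    using assms by (simp flip: power_add)
  finally show ?thesis
    by (simp add: binomial_envelope_def power_divide)
qed

lemma mult_ln_above_tangent:
  fixes x y :: real
  assumes "0 < x" "0 < y" "x \<noteq> y"
  shows "x * ln y + (x - y) < x * ln x"
proof -
  have "ln (y / x) \<noteq> y / x - 1"
    using assms ln_eq_minus_one[of "y / x"] by auto
  then have "ln (y / x) < y / x - 1"
    using assms ln_le_minus_one[of "y / x"] by simp
  then have "x * (ln y - ln x) < x * (y / x - 1)"
    using assms by (simp add: ln_div)
  also have "\<dots> = y - x"
    using assms by (simp add: field_simps)
  finally show ?thesis by (simp add: algebra_simps)
qed

lemma binomial_envelope_less:
  assumes "0 < k" "k < n" "2 * k \<noteq> n"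
  shows "binomial_envelope n k < 2 ^ n / sqrt (real n)"
proof -
  define x y where "x = real k" and "y = real (n - k)"
  have pos: "0 < x" "0 < y" and neq: "x \<noteq> y" and n: "real n = x + y"
    using assms by (auto simp: x_def y_def)
  have ln_half: "ln ((x + y) / 2) = ln (x + y) - ln 2"
    using pos by (simp add: ln_div)
  have "x * ln ((x + y) / 2) + (x - (x + y) / 2) < x * ln x"
    using pos neq by (intro mult_ln_above_tangent) auto
  moreover have "y * ln ((x + y) / 2) + (y - (x + y) / 2) < y * ln y"
    using pos neq by (intro mult_ln_above_tangent) auto
  ultimately have "(x + y) * ln (x + y) - x * ln x - y * ln y < (x + y) * ln 2"
    unfolding ln_half by (simp add: field_simps)
  then have "ln (binomial_envelope n k) < ln (2 ^ n / sqrt (real n))"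
    using assms pos
    by (simp add: ln_binomial_envelope ln_div ln_realpow ln_sqrt n flip: x_def y_def)
      (simp add: algebra_simps)
  then show ?thesis
    using assms binomial_envelope_pos[of k n] by (subst (asm) ln_less_cancel_iff) auto
qed

lemma binomial_envelope_le:
  assumes "0 < k" "k < n"
  shows "binomial_envelope n k \<le> 2 ^ n / sqrt (real n)"
proof (cases "2 * k = n")
  case True
  then have "n - k = k" "real n / real k = 2" "k + k = n" using assms by auto
  then show ?thesis
    using assms by (simp add: binomial_envelope_altdef flip: power_add)
next
  case False
  then show ?thesis
    using binomial_envelope_less[OF assms] by simp
qed

definition ln_binomial_ratio :: "nat \<Rightarrow> nat \<Rightarrow> real" where
  "ln_binomial_ratio n k = ln (real (n choose k) / binomial_envelope n k)"

lemma ln_binomial_ratio_eq_stirling_remainder: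
  assumes "0 < k" "k < n"
  shows "ln_binomial_ratio n k
    = stirling_remainder n - stirling_remainder k - stirling_remainder (n - k)
      + ln (real n ^ 2 / (real k * real (n - k))) / 2"
proof -
  have "ln (real n ^ 2 / (real k * real (n - k)))
      = 2 * ln (real n) - ln (real k) - ln (real (n - k))"
    using assms by (simp add: ln_div ln_mult ln_realpow)
  moreover
  have "ln (real (n choose k)) = ln (fact n) - ln (fact k) - ln (fact (n - k))"
    using assms by (simp add: binomial_fact ln_div ln_mult)
  then have "ln_binomial_ratio n k = ln (fact n) - ln (fact k) - ln (fact (n - k))
      - ((real n - 1 / 2) * ln (real n) - real k * ln (real k)
         - real (n - k) * ln (real (n - k)))"
    using assms binomial_envelope_pos[OF assms]
    by (simp add: ln_binomial_ratio_def ln_div ln_binomial_envelope)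
  ultimately show ?thesis
    using assms unfolding stirling_remainder_def by simp (simp add: field_simps)
qed

lemma ln_binomial_ratio_Suc_le:
  assumes "5 \<le> k" "2 * Suc k \<le> n"
  shows "ln_binomial_ratio n (Suc k) + 11 / (12 * real n ^ 2) \<le> ln_binomial_ratio n k"
proof -
  define m where "m = n - Suc k"
  define x y where "x = real k" and "y = real m"
  have xy: "5 \<le> x" "x + 1 \<le> y" and n: "real n = x + y + 1"
    and m: "0 < m" "n - k = Suc m"
    using assms by (auto simp: x_def y_def m_def)
  have "ln_binomial_ratio n k - ln_binomial_ratio n (Suc k)
      = y * (ln (y + 1) - ln y) - x * (ln (x + 1) - ln x)"
    using assms
    by (simp add: ln_binomial_ratio_eq_stirling_remainder stirling_remainder_Suc m
        ln_div ln_mult ln_realpow flip: m_def) (simp add: x_def y_def field_simps)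
  moreover have "1 - 1 / (2 * x + 3) \<le> y * (ln (y + 1) - ln y)"
  proof -
    have "1 / (2 * y + 1) \<le> 1 / (2 * x + 3)"
      using xy by (intro divide_left_mono) auto
    then show ?thesis
      using mult_ln_plus_one_diff_ge[of y] xy by linarith
  qed
  moreover have "x * (ln (x + 1) - ln x) \<le> 1 - 1 / (2 * (x + 1))"
    using xy by (intro mult_ln_plus_one_diff_le) auto
  moreover have "11 / (12 * real n ^ 2) \<le> 11 / (12 * (2 * (x + 1)) ^ 2)"
    using xy n by (intro divide_left_mono mult_left_mono power_mono) auto
  moreover have "11 / (12 * (2 * (x + 1)) ^ 2) \<le> 1 / (2 * (x + 1)) - 1 / (2 * x + 3)"
    using xy by (simp add: divide_simps power2_eq_square)
  ultimately show ?thesis by linarith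
qed

lemma ln_binomial_ratio_decrease:
  assumes "5 \<le> j" "j \<le> k" "2 * k \<le> n"
  shows "ln_binomial_ratio n k + (real k - real j) * (11 / (12 * real n ^ 2))
    \<le> ln_binomial_ratio n j"
  using assms(2,3)
proof (induction k rule: dec_induct)
  case (step k)
  define c where "c = 11 / (12 * real n ^ 2)"
  have "ln_binomial_ratio n (Suc k) + c \<le> ln_binomial_ratio n k"
    unfolding c_def using step assms(1) by (intro ln_binomial_ratio_Suc_le) auto
  moreover have "ln_binomial_ratio n k + (real k - real j) * c \<le> ln_binomial_ratio n j"
    unfolding c_def using step by simp
  ultimately show ?case
    by (simp add: algebra_simps flip: c_def)
qed simp

lemma ln_binomial_ratio_le_Suc_left:
  assumes "0 < k" "2 * k \<le> n"
  shows "ln_binomial_ratio n k \<le> ln_binomial_ratio (Suc n) k"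
proof -
  define x y where "x = real n" and "y = real (n - k)"
  have xy: "0 < x" "0 < y" "x \<le> 2 * y"
    using assms by (auto simp: x_def y_def)
  have "ln_binomial_ratio (Suc n) k - ln_binomial_ratio n k
      = y * (ln (y + 1) - ln y) - x * (ln (x + 1) - ln x) + (ln (x + 1) - ln x) / 2"
    using assms
    by (simp add: ln_binomial_ratio_eq_stirling_remainder stirling_remainder_Suc Suc_diff_le
        ln_div ln_mult ln_realpow) (simp add: x_def y_def field_simps)
  moreover have "1 - 1 / (x + 1) \<le> y * (ln (y + 1) - ln y)"
  proof -
    have "1 / (2 * y + 1) \<le> 1 / (x + 1)"
      using xy by (intro divide_left_mono) auto
    then show ?thesis
      using mult_ln_plus_one_diff_ge[of y] xy by linarith
  qed
  moreover have "x * (ln (x + 1) - ln x) \<le> 1 - 1 / (2 * (x + 1))"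
    using xy by (intro mult_ln_plus_one_diff_le)
  moreover have "1 / (2 * x + 1) \<le> (ln (x + 1) - ln x) / 2"
    using ln_plus_one_diff_ge[of x] xy by simp
  moreover have "1 / (x + 1) \<le> 1 / (2 * (x + 1)) + 1 / (2 * x + 1)"
    using xy by (simp add: divide_simps) (simp add: algebra_simps)
  ultimately show ?thesis by linarith
qed

lemma ln_binomial_ratio_mono_left:
  assumes "0 < k" "2 * k \<le> m" "m \<le> n"
  shows "ln_binomial_ratio m k \<le> ln_binomial_ratio n k"
  using assms(3)
proof (induction n rule: dec_induct)
  case (step n)
  then show ?case
    using ln_binomial_ratio_le_Suc_left[of k n] assms by simp
qed simp

text \<open>
  The logarithms are those of \<open>n\<^sup>2 / (k * (n - k))\<close> for \<open>n = 5 k + 4\<close>, at \<open>k = x + 1\<close> and at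
  \<open>k = x\<close>; the fractions bound the change of the Stirling remainders of \<open>k\<close> and \<open>n - k\<close>.
\<close>

lemma ln_square_div_residue_four_decrease:
  fixes x :: real
  assumes "1 \<le> x"
  shows "ln ((5 * x + 9) ^ 2 / ((x + 1) * (4 * x + 8))) / 2
      + (1 / (8 * x) - 1 / (8 * (x + 1)) + 1 / (8 * (4 * x + 4)) - 1 / (8 * (4 * x + 8)))
    \<le> ln ((5 * x + 4) ^ 2 / (x * (4 * x + 4))) / 2" (is "ln ?b / 2 + ?d \<le> ln ?a / 2")
proof -
  define r where "r = (15 * x + 32) / ((5 * x + 4) ^ 2 * (x + 2))"
  have pos: "0 < ?b" "0 < ?a" using assms by auto
  have "?b / ?a = ((5 * x + 9) ^ 2 * x) / ((5 * x + 4) ^ 2 * (x + 2))"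
    using assms by (simp add: divide_simps) (simp add: algebra_simps)
  also have "\<dots> = 1 - r"
    using assms by (simp add: r_def divide_simps) (simp add: power2_eq_square algebra_simps)
  finally have quotient: "?b / ?a = 1 - r" .
  have "ln ?b - ln ?a = ln (?b / ?a)"
    by (rule ln_divide_pos[OF pos, symmetric])
  also have "\<dots> \<le> ?b / ?a - 1"
    by (rule ln_le_minus_one[OF divide_pos_pos[OF pos]])
  finally have "ln ?b - ln ?a \<le> - r"
    unfolding quotient by simp
  moreover have "?d = (5 * x + 8) / (32 * x * (x + 1) * (x + 2))"
    using assms by (simp add: divide_simps) (simp add: algebra_simps)
  moreover have "(5 * x + 8) / (32 * x * (x + 1) * (x + 2)) \<le> r / 2"
  proof -
    have "(15 * x + 32) * (32 * x * (x + 1)) - 2 * ((5 * x + 8) * (5 * x + 4) ^ 2)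
        = 230 * x ^ 3 + 704 * x ^ 2 + 224 * x - 256"
      by (simp add: power2_eq_square power3_eq_cube algebra_simps)
    moreover have "1 \<le> x ^ 2" "1 \<le> x ^ 3"
      using assms by (simp_all add: one_le_power)
    ultimately have "2 * ((5 * x + 8) * (5 * x + 4) ^ 2) \<le> (15 * x + 32) * (32 * x * (x + 1))"
      using assms by linarith
    then show ?thesis
      using assms by (simp add: r_def divide_simps ac_simps)
  qed
  ultimately show ?thesis by argo
qed

lemma ln_binomial_ratio_residue_four_Suc_le:
  assumes "0 < k"
  shows "ln_binomial_ratio (5 * Suc k + 4) (Suc k) \<le> ln_binomial_ratio (5 * k + 4) k"
proof -
  define x where "x = real k"
  have x: "1 \<le> x" using assms by (simp add: x_def)
  have "ln_binomial_ratio (5 * Suc k + 4) (Suc k)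
      = stirling_remainder (5 * Suc k + 4) - stirling_remainder (Suc k)
        - stirling_remainder (4 * k + 8) + ln ((5 * x + 9) ^ 2 / ((x + 1) * (4 * x + 8))) / 2"
    using ln_binomial_ratio_eq_stirling_remainder[of "Suc k" "5 * Suc k + 4"] assms
    by (simp add: x_def add.commute mult.commute)
  moreover have "ln_binomial_ratio (5 * k + 4) k
      = stirling_remainder (5 * k + 4) - stirling_remainder k
        - stirling_remainder (4 * k + 4) + ln ((5 * x + 4) ^ 2 / (x * (4 * x + 4))) / 2"
    using ln_binomial_ratio_eq_stirling_remainder[of k "5 * k + 4"] assms
    by (simp add: x_def add.commute mult.commute)
  moreover have "stirling_remainder (5 * Suc k + 4) \<le> stirling_remainder (5 * k + 4)"
    by (rule stirling_remainder_antimono) auto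
  moreover have "stirling_remainder k - 1 / (8 * x)
      \<le> stirling_remainder (Suc k) - 1 / (8 * (x + 1))"
    using stirling_remainder_minus_inverse_mono[of k "Suc k"] assms
    by (simp add: x_def algebra_simps)
  moreover have "stirling_remainder (4 * k + 4) - 1 / (8 * (4 * x + 4))
      \<le> stirling_remainder (4 * k + 8) - 1 / (8 * (4 * x + 8))"
    using stirling_remainder_minus_inverse_mono[of "4 * k + 4" "4 * k + 8"]
    by (simp add: x_def mult.commute)
  ultimately show ?thesis
    using ln_square_div_residue_four_decrease[OF x] by linarith
qed

lemma ln_binomial_ratio_residue_four_antimono:
  assumes "0 < j" "j \<le> k"
  shows "ln_binomial_ratio (5 * k + 4) k \<le> ln_binomial_ratio (5 * j + 4) j"
  using assms(2)
proof (induction k rule: dec_induct)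
  case (step k)
  then show ?case
    using ln_binomial_ratio_residue_four_Suc_le[of k] assms(1) by simp
qed simp

text \<open>Products of integer lists, unlike factorials, are evaluated quickly by \<open>code_simp\<close>.\<close>

lemma prod_list_upto_eq_fact_mult_choose:
  "prod_list [int m + 1..int m + int k] = fact k * int (m + k choose k)"
proof (induction k)
  case (Suc k)
  have "prod_list [int m + 1..int m + int (Suc k)]
      = prod_list [int m + 1..int m + int k] * int (Suc (m + k))"
    by (subst upto_rec2) (simp_all add: algebra_simps)
  also have "\<dots> = fact k * int (Suc (m + k) * (m + k choose k))"
    by (simp only: Suc.IH of_nat_mult mult_ac)
  also have "\<dots> = fact k * int (Suc k * (Suc (m + k) choose Suc k))"
    by (simp only: Suc_times_binomial)
  finally show ?case
    by (simp only: fact_Suc of_nat_mult add_Suc_right mult_ac)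
qed simp

text \<open>
  The number \<open>673864 * 10 ^ 16\<close> is \<open>(404 / 80) ^ 20 * (404 / 324) ^ 81\<close> rounded down, and
  \<open>2009976 / 10 ^ 5\<close> is \<open>sqrt 404\<close> rounded up.
\<close>

lemma binomial_404_80_less: "real (404 choose 80) * 2009976 < 673864 ^ 4 * 10 ^ 69"
proof -
  have "prod_list [325..404] * 2009976 < 673864 ^ 4 * 10 ^ 69 * prod_list [1..80::int]"
    by code_simp
  moreover have "prod_list [325..404] = fact 80 * int (404 choose 80)"
    using prod_list_upto_eq_fact_mult_choose[of 324 80] by (simp del: upto_rec_numeral)
  moreover have "prod_list [1..80] = (fact 80 :: int)"
    using prod_list_upto_eq_fact_mult_choose[of 0 80] by (simp del: upto_rec_numeral)
  ultimately have "fact 80 * (int (404 choose 80) * 2009976)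
      < fact 80 * (673864 ^ 4 * 10 ^ 69)"
    by (simp only: mult_ac)
  then have "int (404 choose 80) * 2009976 < 673864 ^ 4 * 10 ^ 69"
    by (simp only: mult_less_cancel_left_pos fact_gt_zero)
  then have "real_of_int (int (404 choose 80) * 2009976) < real_of_int (673864 ^ 4 * 10 ^ 69)"
    by (simp only: of_int_less_iff)
  then show ?thesis by simp
qed

lemma binomial_less_envelope_404_80: "real (404 choose 80) < binomial_envelope 404 80"
proof -
  define p q :: real where "p = 404 / 80" and "q = 404 / 324"
  have "binomial_envelope 404 80
      = (real 404 / real 80) ^ 80 * (real 404 / real (404 - 80)) ^ (404 - 80) / sqrt (real 404)"
    by (rule binomial_envelope_altdef) simp_all
  also have "404 - 80 = (324 :: nat)" by simp
  finally have envelope: "binomial_envelope 404 80 = p ^ 80 * q ^ 324 / sqrt 404"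
    by (simp only: p_def q_def of_nat_numeral)
  have "sqrt 404 < 2009976 / 10 ^ 5"
    by (rule real_less_lsqrt) (simp_all add: power2_eq_square)
  then have "real (404 choose 80) * sqrt 404 < real (404 choose 80) * (2009976 / 10 ^ 5)"
    by (intro mult_strict_left_mono) auto
  also have "\<dots> < (673864 * 10 ^ 16) ^ 4"
    using binomial_404_80_less by simp
  also have "\<dots> < (p ^ 20 * q ^ 81) ^ 4"
  proof (rule power_strict_mono)
    show "673864 * 10 ^ 16 < p ^ 20 * q ^ 81"
      by (simp add: p_def q_def power_divide)
  qed simp_all
  also have "\<dots> = p ^ 80 * q ^ 324"
    by (simp add: power_mult_distrib flip: power_mult)
  finally show ?thesis
    unfolding envelope by (simp add: pos_less_divide_eq)
qed

lemma ln_binomial_ratio_fifth_neg: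
  assumes "400 \<le> n"
  shows "ln_binomial_ratio n (n div 5) < 0"
proof -
  define k where "k = n div 5"
  have k: "80 \<le> k" "2 * k \<le> n" "n \<le> 5 * k + 4" using assms by (auto simp: k_def)
  then have "ln_binomial_ratio n k \<le> ln_binomial_ratio (5 * k + 4) k"
    by (intro ln_binomial_ratio_mono_left) auto
  also have "\<dots> \<le> ln_binomial_ratio 404 80"
    using ln_binomial_ratio_residue_four_antimono[of 80 k] k by simp
  also have "\<dots> < 0"
    using binomial_less_envelope_404_80 binomial_envelope_pos[of 80 404]
    by (simp add: ln_binomial_ratio_def)
  finally show ?thesis by (simp add: k_def)
qed

lemma binomial_less_exp_envelope:
  assumes "400 \<le> n" "n div 5 \<le> k" "2 * k \<le> n"
  shows "real (n choose k)
    < exp (- (real k - real (n div 5)) * (11 / (12 * real n ^ 2))) * binomial_envelope n k"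
proof -
  have "0 < k" "k < n" using assms by auto
  then have pos: "0 < real (n choose k)" "0 < binomial_envelope n k"
    by (simp_all add: binomial_envelope_pos)
  have "5 \<le> n div 5" using assms(1) by simp
  then have "ln_binomial_ratio n k < - (real k - real (n div 5)) * (11 / (12 * real n ^ 2))"
    using ln_binomial_ratio_decrease[OF _ assms(2,3)] ln_binomial_ratio_fifth_neg[OF assms(1)]
    unfolding mult_minus_left by linarith
  then have "exp (ln_binomial_ratio n k)
      < exp (- (real k - real (n div 5)) * (11 / (12 * real n ^ 2)))"
    by simp
  moreover have "exp (ln_binomial_ratio n k) = real (n choose k) / binomial_envelope n k"
    using pos by (simp add: ln_binomial_ratio_def)
  ultimately show ?thesis
    using pos by (simp add: pos_divide_less_eq)
qed

lemma exp_minus_less_linear: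
  fixes a b t :: real
  assumes "0 \<le> b" "b < a" "0 < t" "a * b * t < a - b"
  shows "exp (- (a * t)) < 1 - b * t"
proof -
  have "0 < t * (a - b - a * b * t)"
    using assms by (intro mult_pos_pos) auto
  then have one_less: "1 < (1 - b * t) * (1 + a * t)"
    by (simp add: algebra_simps)
  moreover have "0 < 1 + a * t"
    using assms by (intro add_pos_nonneg mult_nonneg_nonneg) auto
  ultimately have "0 < 1 - b * t"
    using zero_less_mult_pos2[of "1 - b * t" "1 + a * t"] by linarith
  then have "(1 - b * t) * (1 + a * t) \<le> (1 - b * t) * exp (a * t)"
    by (intro mult_left_mono exp_ge_add_one_self) auto
  with one_less show ?thesis
    by (simp add: exp_minus field_simps)
qed

theorem theorem2p4:
  fixes k n :: nat
  assumes "k > 0" and "n \<ge> 400"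
    and "\<lfloor>real n / 5\<rfloor> \<le> int k" and "int k \<le> \<lfloor>real n / 2\<rfloor>"
  shows "let d = real k - real_of_int \<lfloor>real n / 5\<rfloor>;
             M = real n powr (real n - 1/2) / (real k ^ k * real (n - k) ^ (n - k));
             A = exp (- d * (11 / (12 * real n ^ 2))) * M;
             B = (1 - 5 * d / (6 * real n ^ 2)) * M;
             C = (1 - 5 * d / (6 * real n ^ 2)) * (2 ^ n / sqrt (real n))
         in real (n choose k) < A \<and> A \<le> B \<and> B \<le> C \<and>
            (\<lfloor>real n / 5\<rfloor> \<noteq> int k \<longrightarrow> A < B) \<and>
            (2 * k \<noteq> n \<longrightarrow> B < C)"
proof -
  have floors: "\<lfloor>real n / 5\<rfloor> = int (n div 5)" "\<lfloor>real n / 2\<rfloor> = int (n div 2)"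
    using floor_divide_of_nat_eq[of n 5] floor_divide_of_nat_eq[of n 2] by simp_all
  have k: "n div 5 \<le> k" "2 * k \<le> n" "k < n" using assms by (auto simp: floors)
  define d where "d = real k - real (n div 5)"
  define t where "t = d / real n ^ 2"
  have rates: "- d * (11 / (12 * real n ^ 2)) = - (11 / 12 * t)"
    "5 * d / (6 * real n ^ 2) = 5 / 6 * t"
    by (simp_all add: t_def)
  have "400 * d \<le> real n * real n"
    using assms(2) k by (intro mult_mono) (auto simp: d_def)
  then have t: "0 \<le> t" "t \<le> 1 / 400" "t = 0 \<longleftrightarrow> n div 5 = k"
    using assms(2) k by (auto simp: t_def d_def field_simps power2_eq_square)
  have exp_less: "exp (- (11 / 12 * t)) < 1 - 5 / 6 * t" if "n div 5 \<noteq> k"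
    using t that by (intro exp_minus_less_linear) auto
  define M C where "M = binomial_envelope n k" and "C = 2 ^ n / sqrt (real n)"
  have "real (n choose k) < exp (- (11 / 12 * t)) * M"
    using binomial_less_exp_envelope[OF assms(2) k(1,2)] unfolding M_def rates[symmetric] d_def .
  moreover have "0 < M" "M \<le> C" "2 * k \<noteq> n \<Longrightarrow> M < C"
    using assms(1) k(3) binomial_envelope_pos binomial_envelope_le binomial_envelope_less
    by (simp_all add: M_def C_def)
  ultimately show ?thesis
    using exp_less t unfolding floors Let_def of_int_of_nat_eq binomial_envelope_def[symmetric]
      d_def[symmetric] rates M_def[symmetric] C_def[symmetric]
    by (cases "n div 5 = k") auto
qed

end
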